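(* Let $A\succ0$ be a $d\times d$ real symmetric matrix with smallest eigenvalue $\lambda_{\min}^A$ and condition number $\kappa(A)$, and let $\gamma\in[0,1]$. The algorithm LAI$(\gamma)$ has the following two properties. (i) In the stochastic setting where the minimizers $\{v_t\}_{t=1}^T$ form a martingale with increments having identical covariance $\Sigma$, with $\sigma^2=\mathrm{tr}(\Sigma)$, LAI$(\gamma)$ has constant regret (bounded independently of $T$): $$\mathrm{Regret}_{\mathrm{LAI}(\gamma)}[1,T]\le\frac{\sigma^2}{4}\left(\frac{\left(1+\frac{4}{\lambda_{\min}^A}\right)^{\gamma/2}-1}{\lambda_{\min}^A+2}\right).$$ (ii) In the adversarial setting its competitive ratio satisfies $$\mathrm{CR}_{\mathrm{LAI}(\gamma)}\le1+\max\left\{\frac12\left(\sqrt{\kappa(A)^2+\frac{4\kappa(A)}{\lambda_{\min}^A}}-\kappa(A)\right),\ \frac{2}{\lambda_{\min}^A}\left(\left(1+\frac{4}{\lambda_{\min}^A}\right)^{\gamma/2}+1\right)^{-1}\right\}.$$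
   Context: Smoothed online quadratic optimization: starting from a given deterministic $x_0\in\mathbb{R}^d$, at each round $t=1,\dots,T$ the vector $v_t\in\mathbb{R}^d$ is revealed and the player picks $x_t$, paying $f_t(x_t)+\frac12\|x_t-x_{t-1}\|_2^2$ with $f_t(x)=\frac12(x-v_t)^TA(x-v_t)$; $\mathrm{Cost}[1,T]$ is the sum over $t=1,\dots,T$. LAI$(\gamma)$: write $A=PD_AP^T$ with $P$ orthogonal, $D_A=\mathrm{diag}(\lambda_1^A,\dots,\lambda_d^A)$. Let $\tilde\lambda_i^T=\left(1+\lambda_i^A+\frac{\lambda_i^A}{2}\left(\left(1+\frac{4}{\lambda_i^A}\right)^{\gamma/2}-1\right)\right)^{-1}$ (superscript $T$ is the horizon index), $\tilde C_T=P\,\mathrm{diag}(\tilde\lambda_1^T,\dots,\tilde\lambda_d^T)P^T$ (the outer superscript on the last $P$ being transpose), and $\tilde C_t^{-1}=2I+A-\tilde C_{t+1}$ for $1\le t\le T-1$. The algorithm plays $x_t=\tilde C_tx_{t-1}+(I-\tilde C_t)v_t$. Stochastic setting: $v_0=x_0$; $\mathcal{F}_t=\sigma(v_1,\dots,v_t)$; $\mathbb{E}[v_s\mid\mathcal{F}_t]=v_t$ for $s\ge t$; $\Sigma=\mathbb{E}[(v_t-v_{t-1})(v_t-v_{t-1})^T]$, finite. $\mathrm{Regret}_{\mathrm{ALG}}[1,T]=\mathbb{E}[\mathrm{Cost}_{\mathrm{ALG}}[1,T]]-\mathbb{E}[\mathrm{Cost}^*[1,T]]$, where $\mathbb{E}[\mathrm{Cost}^*[1,T]]$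 is the minimum expected cost over all online ($\mathcal{F}_t$-adapted) algorithms; this minimum is attained by the algorithm LAI, $x_t=C_tx_{t-1}+(I-C_t)v_t$ with $C_T=(I+A)^{-1}$, $C_t^{-1}=2I+A-C_{t+1}$. Adversarial setting: $v_1,\dots,v_T$ arbitrary; $\mathrm{Cost}_{\mathrm{OPT}}[1,T]$ is the minimum total cost over all sequences chosen in hindsight; $\mathrm{CR}_{\mathrm{ALG}}\le\rho$ means $\mathrm{Cost}_{\mathrm{ALG}}[1,T]\le\rho\,\mathrm{Cost}_{\mathrm{OPT}}[1,T]$ for every $T$, $x_0$ and $\{v_t\}$. *)

theory Defs
  imports "HOL-Probability.Probability"
begin

section \<open>Matrices\<close>

definition diag_matrix :: "('n::finite \<Rightarrow> real) \<Rightarrow> real^'n^'n" where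
  "diag_matrix l = (\<chi> i j. if i = j then l i else 0)"

definition sym_pos_def :: "real^'n^'n \<Rightarrow> bool" where
  "sym_pos_def A \<longleftrightarrow> transpose A = A \<and> (\<forall>x. x \<noteq> 0 \<longrightarrow> x \<bullet> (A *v x) > 0)"

definition eigenvalues :: "real^'n^'n \<Rightarrow> real set" where
  "eigenvalues A = {l. \<exists>x. x \<noteq> 0 \<and> A *v x = l *\<^sub>R x}"

definition lambda_min :: "real^'n^'n \<Rightarrow> real" where
  "lambda_min A = Min (eigenvalues A)"

definition lambda_max :: "real^'n^'n \<Rightarrow> real" where
  "lambda_max A = Max (eigenvalues A)"

text \<open>The condition number of a symmetric positive definite matrix.\<close>
definition cond_number :: "real^'n^'n \<Rightarrow> real" where
  "cond_number A = lambda_max A / lambda_min A"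

section \<open>Smoothed online quadratic optimization\<close>

definition hitting_cost :: "real^'n^'n \<Rightarrow> real^'n \<Rightarrow> real^'n \<Rightarrow> real" where
  "hitting_cost A v x = ((x - v) \<bullet> (A *v (x - v))) / 2"

text \<open>A trajectory is a function \<open>x\<close> on the naturals whose value at \<open>0\<close> is the starting point.\<close>
definition total_cost ::
  "real^'n^'n \<Rightarrow> nat \<Rightarrow> (nat \<Rightarrow> real^'n) \<Rightarrow> (nat \<Rightarrow> real^'n) \<Rightarrow> real" where
  "total_cost A T v x =
     (\<Sum>t = 1..T. hitting_cost A (v t) (x t) + (norm (x t - x (t - 1)))\<^sup>2 / 2)"

text \<open>An algorithm maps a horizon, a starting point and a sequence of minimizers to a trajectory.\<close>
type_synonym 'n algorithm = "nat \<Rightarrow> real^'n \<Rightarrow> (nat \<Rightarrow> real^'n) \<Rightarrow> nat \<Rightarrow> real^'n"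

section \<open>The algorithm LAI(\<open>\<gamma>\<close>)\<close>

definition lai_terminal_eig :: "real \<Rightarrow> real \<Rightarrow> real" where
  "lai_terminal_eig \<gamma> l = inverse (1 + l + l / 2 * ((1 + 4 / l) powr (\<gamma> / 2) - 1))"

text \<open>\<open>lai_back P l A \<gamma> k\<close> is the matrix used \<open>k\<close> rounds before the horizon, where
  \<open>A = P ** diag_matrix l ** transpose P\<close>; \<open>mat 2\<close> is twice the identity matrix.\<close>
primrec lai_back ::
  "real^'n^'n \<Rightarrow> ('n \<Rightarrow> real) \<Rightarrow> real^'n^'n \<Rightarrow> real \<Rightarrow> nat \<Rightarrow> real^'n^'n" where
  "lai_back P l A \<gamma> 0 = P ** diag_matrix (\<lambda>i. lai_terminal_eig \<gamma> (l i)) ** transpose P"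
| "lai_back P l A \<gamma> (Suc k) = matrix_inv (mat 2 + A - lai_back P l A \<gamma> k)"

definition lai_C ::
  "real^'n^'n \<Rightarrow> ('n \<Rightarrow> real) \<Rightarrow> real^'n^'n \<Rightarrow> real \<Rightarrow> nat \<Rightarrow> nat \<Rightarrow> real^'n^'n" where
  "lai_C P l A \<gamma> T t = lai_back P l A \<gamma> (T - t)"

primrec lai ::
  "real^'n^'n \<Rightarrow> ('n \<Rightarrow> real) \<Rightarrow> real^'n^'n \<Rightarrow> real \<Rightarrow> 'n algorithm" where
  "lai P l A \<gamma> T x0 v 0 = x0"
| "lai P l A \<gamma> T x0 v (Suc t) =
     lai_C P l A \<gamma> T (Suc t) *v lai P l A \<gamma> T x0 v t
     + (mat 1 - lai_C P l A \<gamma> T (Suc t)) *v v (Suc t)"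

section \<open>Stochastic setting\<close>

text \<open>The \<open>\<sigma>\<close>-algebra generated by \<open>v 1, \<dots>, v t\<close>; it is trivial for \<open>t = 0\<close>.\<close>
definition nat_filt :: "'a measure \<Rightarrow> (nat \<Rightarrow> 'a \<Rightarrow> real^'n) \<Rightarrow> nat \<Rightarrow> 'a measure" where
  "nat_filt M v t =
     sigma (space M) (\<Union>s\<in>{1..t}. {v s -` B \<inter> space M | B. B \<in> sets borel})"

text \<open>The conditional expectation of a random vector is taken componentwise.\<close>
definition martingale_minimizers ::
  "'a measure \<Rightarrow> nat \<Rightarrow> real^'n \<Rightarrow> (nat \<Rightarrow> 'a \<Rightarrow> real^'n) \<Rightarrow> bool" where
  "martingale_minimizers M T x0 v \<longleftrightarrow>
     (\<forall>\<omega>\<in>space M. v 0 \<omega> = x0) \<and>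
     (\<forall>t\<in>{1..T}. integrable M (v t)) \<and>
     (\<forall>s t. t \<le> s \<and> s \<le> T \<longrightarrow>
        (\<forall>i. AE \<omega> in M. real_cond_exp M (nat_filt M v t) (\<lambda>\<omega>. v s \<omega> $ i) \<omega> = v t \<omega> $ i))"

definition increments_covariance ::
  "'a measure \<Rightarrow> nat \<Rightarrow> (nat \<Rightarrow> 'a \<Rightarrow> real^'n) \<Rightarrow> real^'n^'n \<Rightarrow> bool" where
  "increments_covariance M T v \<Sigma> \<longleftrightarrow>
     (\<forall>t\<in>{1..T}. \<forall>i j.
        has_bochner_integral M
          (\<lambda>\<omega>. (v t \<omega> - v (t - 1) \<omega>) $ i * (v t \<omega> - v (t - 1) \<omega>) $ j) (\<Sigma> $ i $ j))"

definition online_strategies ::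
  "'a measure \<Rightarrow> nat \<Rightarrow> real^'n \<Rightarrow> (nat \<Rightarrow> 'a \<Rightarrow> real^'n) \<Rightarrow> (nat \<Rightarrow> 'a \<Rightarrow> real^'n) set" where
  "online_strategies M T x0 v =
     {x. (\<forall>\<omega>\<in>space M. x 0 \<omega> = x0) \<and> (\<forall>t\<in>{1..T}. x t \<in> borel_measurable (nat_filt M v t))}"

text \<open>Costs are nonnegative for positive definite \<open>A\<close>, so their expectation always exists in
  \<open>[0, \<infinity>]\<close>; no strategy has to be excluded for lack of integrability.\<close>
definition expected_cost ::
  "real^'n^'n \<Rightarrow> nat \<Rightarrow> 'a measure \<Rightarrow> (nat \<Rightarrow> 'a \<Rightarrow> real^'n) \<Rightarrow> (nat \<Rightarrow> 'a \<Rightarrow> real^'n) \<Rightarrow> ennreal" where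
  "expected_cost A T M v x =
     (\<integral>\<^sup>+ \<omega>. ennreal (total_cost A T (\<lambda>t. v t \<omega>) (\<lambda>t. x t \<omega>)) \<partial>M)"

definition optimal_expected_cost ::
  "real^'n^'n \<Rightarrow> nat \<Rightarrow> 'a measure \<Rightarrow> real^'n \<Rightarrow> (nat \<Rightarrow> 'a \<Rightarrow> real^'n) \<Rightarrow> ennreal" where
  "optimal_expected_cost A T M x0 v =
     (INF x\<in>online_strategies M T x0 v. expected_cost A T M v x)"

text \<open>In \<open>ereal\<close> one has \<open>\<infinity> - r = \<infinity>\<close> for every \<open>r\<close>, including \<open>r = \<infinity>\<close>, so a finite upper bound
  on the regret entails that the expected cost of the algorithm is finite.\<close>
definition regret ::
  "real^'n^'n \<Rightarrow> 'n algorithm \<Rightarrow> nat \<Rightarrow> 'a measure \<Rightarrow> real^'n \<Rightarrow> (nat \<Rightarrow> 'a \<Rightarrow> real^'n) \<Rightarrow> ereal" where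
  "regret A alg T M x0 v =
     enn2ereal (expected_cost A T M v (\<lambda>t \<omega>. alg T x0 (\<lambda>s. v s \<omega>) t))
     - enn2ereal (optimal_expected_cost A T M x0 v)"

section \<open>Adversarial setting\<close>

definition offline_cost :: "real^'n^'n \<Rightarrow> nat \<Rightarrow> real^'n \<Rightarrow> (nat \<Rightarrow> real^'n) \<Rightarrow> real" where
  "offline_cost A T x0 v = (INF y\<in>{y. y 0 = x0}. total_cost A T v y)"

definition competitive_ratio_le :: "real^'n^'n \<Rightarrow> 'n algorithm \<Rightarrow> real \<Rightarrow> bool" where
  "competitive_ratio_le A alg \<rho> \<longleftrightarrow>
     (\<forall>T x0 v. 1 \<le> T \<longrightarrow> total_cost A T v (alg T x0 v) \<le> \<rho> * offline_cost A T x0 v)"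

end

theory Submission
  imports Defs
begin

text \<open>In the eigenbasis of \<open>A\<close> costs and algorithm split into scalar problems. With
  \<open>a\<^sub>t = 1 - C\<^sub>t\<close> the scalar recursion reads \<open>a\<^sub>t = 1 - 1 / (1 + l + a\<^sub>t\<^sub>+\<^sub>1)\<close>; LAI(\<open>\<gamma>\<close>) starts it at the
  terminal weight \<open>a\<^sub>T\<^sub>+\<^sub>1 = q\<close>, the optimal online algorithm at \<open>0\<close>. Completing squares, with
  \<open>y\<^sub>t = x\<^sub>t - v\<^sub>t\<close> and \<open>d\<^sub>t = v\<^sub>t - v\<^sub>t\<^sub>-\<^sub>1\<close>, turns the cost of any trajectory into
  \<open>\<Sum> a\<^sub>t (d\<^sub>t\<^sup>2 / 2 - y\<^sub>t\<^sub>-\<^sub>1 d\<^sub>t)\<close> plus squares that vanish along the algorithm, minus \<open>q y\<^sub>T\<^sup>2 / 2\<close>.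
  Martingale increments annihilate the cross terms, so the regret is at most \<open>\<sigma>\<^sup>2 / 2\<close> times the
  summed difference of the two sequences, which contracts by \<open>(1 + l)\<^sup>-\<^sup>2\<close> per step. For arbitrary
  \<open>v\<^sub>t\<close> a quadratic potential in the distance to the comparison sequence yields the ratio
  \<open>1 + 1 / (l + q)\<close>, which is largest at the smallest eigenvalue.\<close>

section \<open>The scalar problem\<close>

definition scalar_cost :: "real \<Rightarrow> nat \<Rightarrow> (nat \<Rightarrow> real) \<Rightarrow> (nat \<Rightarrow> real) \<Rightarrow> real" where
  "scalar_cost l T v x = (\<Sum>t = 1..T. (l * (x t - v t)\<^sup>2 + (x t - x (t - 1))\<^sup>2) / 2)"

text \<open>Counted backwards from the horizon: \<open>a\<^sub>t\<close> is \<open>gain l q (Suc T - t)\<close>.\<close>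
primrec gain :: "real \<Rightarrow> real \<Rightarrow> nat \<Rightarrow> real" where
  "gain l q 0 = q"
| "gain l q (Suc k) = 1 - 1 / (1 + l + gain l q k)"

lemma gain_nonneg:
  assumes "0 < l" "0 \<le> q"
  shows "0 \<le> gain l q k"
  using assms by (induction k) auto

text \<open>One step of the recursion divides the difference of two values \<open>a\<close>,
  \<open>b\<close> by \<open>(1 + l + a) * (1 + l + b)\<close>, which is at least
  \<open>(1 + l)^2\<close>. The induction also carries the sign of the difference, since replacing
  the denominator by a smaller one needs a nonnegative numerator.\<close>

lemma gain_diff_le:
  assumes l: "0 < l" and q: "0 \<le> q"
  shows "gain l q k - gain l 0 k \<le> q / (1 + l) ^ (2 * k)"
proof -
  have "0 \<le> gain l q k - gain l 0 k \<and> gain l q k - gain l 0 k \<le> q / (1 + l) ^ (2 * k)"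
  proof (induction k)
    case 0
    then show ?case using q by simp
  next
    case (Suc k)
    define a where "a = gain l q k"
    define b where "b = gain l 0 k"
    have ab: "0 \<le> a" "0 \<le> b"
      using gain_nonneg[OF l] q by (auto simp: a_def b_def)
    have eq: "gain l q (Suc k) - gain l 0 (Suc k) = (a - b) / ((1 + l + a) * (1 + l + b))"
      using l ab by (simp add: a_def[symmetric] b_def[symmetric] field_simps)
    have "(1 + l) * (1 + l) \<le> (1 + l + a) * (1 + l + b)"
      using l ab by (intro mult_mono) auto
    moreover have "0 < (1 + l) * (1 + l)" using l by simp
    moreover have "0 \<le> a - b" using Suc by (simp add: a_def b_def)
    ultimately have "(a - b) / ((1 + l + a) * (1 + l + b)) \<le> (a - b) / ((1 + l) * (1 + l))"
      by (intro divide_left_mono) auto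
    also have "\<dots> \<le> (q / (1 + l) ^ (2 * k)) / ((1 + l) * (1 + l))"
      using Suc l by (intro divide_right_mono) (auto simp: a_def b_def)
    also have "\<dots> = q / (1 + l) ^ (2 * Suc k)"
      by (simp add: field_simps)
    finally show ?case
      using eq ab l \<open>0 \<le> a - b\<close> by simp
  qed
  then show ?thesis by simp
qed

text \<open>A geometric series with ratio \<open>1 / (1 + l)^2\<close>. Rounds \<open>1..T\<close>
  use the indices \<open>k = T..1\<close>, so the initial difference \<open>q\<close> at
  \<open>k = 0\<close> is not counted and the limit is
  \<open>q / ((1 + l)^2 - 1) = q / (l * (l + 2))\<close>.\<close>

lemma sum_gain_diff_le:
  assumes l: "0 < l" and q: "0 \<le> q"
  shows "(\<Sum>t = 1..T. gain l q (Suc T - t) - gain l 0 (Suc T - t)) \<le> q / (l * (l + 2))"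
proof -
  have "(\<Sum>t = 1..T. gain l q (Suc T - t) - gain l 0 (Suc T - t))
      = (\<Sum>k = 1..T. gain l q k - gain l 0 k)"
    by (rule sum.reindex_bij_witness[where i = "\<lambda>t. Suc T - t" and j = "\<lambda>t. Suc T - t"]) auto
  also have "\<dots> \<le> (\<Sum>k = 1..T. q / (1 + l) ^ (2 * k))"
    by (intro sum_mono gain_diff_le l q)
  also have "\<dots> = q / (l * (l + 2)) * (1 - 1 / (1 + l) ^ (2 * T))"
  proof (induction T)
    case (Suc T)
    have geo: "q / (r - 1) * (1 - 1 / X) + q / (r * X) = q / (r - 1) * (1 - 1 / (r * X))"
      if "X \<noteq> 0" "r - 1 \<noteq> 0" "r \<noteq> 0" for X r :: real
      using that by (simp add: field_simps)
    have eqs: "l * (l + 2) = (1 + l)\<^sup>2 - 1" "(1 + l) ^ (2 * Suc T) = (1 + l)\<^sup>2 * (1 + l) ^ (2 * T)"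
      by (auto simp: power2_eq_square algebra_simps)
    have "0 < l * (l + 2)" using l by simp
    then have "(1 + l)\<^sup>2 - 1 \<noteq> 0" unfolding eqs by simp
    then have "q / (l * (l + 2)) * (1 - 1 / (1 + l) ^ (2 * T)) + q / (1 + l) ^ (2 * Suc T)
        = q / (l * (l + 2)) * (1 - 1 / (1 + l) ^ (2 * Suc T))"
      unfolding eqs by (intro geo) (use l in auto)
    then show ?case using Suc by simp
  qed simp
  also have "\<dots> \<le> q / (l * (l + 2)) * 1"
    using l q by (intro mult_left_mono) auto
  finally show ?thesis by simp
qed

text \<open>The positive fixed point of the recursion solves \<open>a^2 + l * a = l\<close>, so the
  hypothesis puts \<open>q\<close> at or below it. From there the iteration increases and never
  crosses the fixed point: a step only divides \<open>a^2 + l * a - l\<close> by a positive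
  square.\<close>

lemma gain_bounds:
  assumes l: "0 < l" and q: "0 \<le> q" and fp: "q\<^sup>2 + l * q \<le> l"
  shows "q \<le> gain l q k" and "(gain l q k)\<^sup>2 + l * gain l q k \<le> l"
proof -
  have "q \<le> gain l q k \<and> (gain l q k)\<^sup>2 + l * gain l q k \<le> l"
  proof (induction k)
    case 0
    then show ?case using fp by simp
  next
    case (Suc k)
    define a where "a = gain l q k"
    have a: "0 \<le> a" "q \<le> a" "a\<^sup>2 + l * a \<le> l" 
      using gain_nonneg[OF l q] Suc by (auto simp: a_def)
    define b where "b = gain l q (Suc k)"
    have b: "b = (l + a) / (1 + l + a)"
      using l a by (simp add: a_def b_def field_simps)
    have "a \<le> b" using l a by (simp add: b field_simps power2_eq_square)
    moreover have "b\<^sup>2 + l * b \<le> l"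
    proof -
      have "b\<^sup>2 + l * b - l = ((l + a)\<^sup>2 + l * (l + a) * (1 + l + a) - l * (1 + l + a)\<^sup>2)
          / (1 + l + a)\<^sup>2"
      proof -
        have "(m / c)\<^sup>2 + l * (m / c) - l = (m\<^sup>2 + l * m * c - l * c\<^sup>2) / c\<^sup>2"
          if "c \<noteq> 0" for m c :: real
          using that by (simp add: field_simps power2_eq_square)
        then show ?thesis using l a unfolding b by simp
      qed
      also have "(l + a)\<^sup>2 + l * (l + a) * (1 + l + a) - l * (1 + l + a)\<^sup>2 = a\<^sup>2 + l * a - l"
        by (simp add: algebra_simps power2_eq_square)
      also have "(a\<^sup>2 + l * a - l) / (1 + l + a)\<^sup>2 \<le> 0"
        using a by (intro divide_nonpos_nonneg) auto
      finally show ?thesis by simp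
    qed
    ultimately show ?case using a by (simp add: b_def)
  qed
  then show "q \<le> gain l q k" "(gain l q k)\<^sup>2 + l * gain l q k \<le> l" by auto
qed

lemma scalar_cost_decomp:
  assumes l: "0 < l" and q: "0 \<le> q" and x0: "x 0 = v 0"
  shows "scalar_cost l T v x =
     (\<Sum>t = 1..T. gain l q (Suc T - t) * ((v t - v (t - 1))\<^sup>2 / 2
                     - (x (t - 1) - v (t - 1)) * (v t - v (t - 1))))
     + (\<Sum>t = 1..T. (1 + l + gain l q (T - t)) / 2
                     * (x t - v t - (x (t - 1) - v t) / (1 + l + gain l q (T - t)))\<^sup>2)
     - q * (x T - v T)\<^sup>2 / 2"
proof -
  have "n \<le> T \<Longrightarrow> (\<Sum>t = 1..n. (l * (x t - v t)\<^sup>2 + (x t - x (t - 1))\<^sup>2) / 2) =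
     (\<Sum>t = 1..n. gain l q (Suc T - t) * ((v t - v (t - 1))\<^sup>2 / 2
                     - (x (t - 1) - v (t - 1)) * (v t - v (t - 1))))
     + (\<Sum>t = 1..n. (1 + l + gain l q (T - t)) / 2
                     * (x t - v t - (x (t - 1) - v t) / (1 + l + gain l q (T - t)))\<^sup>2)
     - gain l q (T - n) * (x n - v n)\<^sup>2 / 2" for n
  proof (induction n)
    case 0
    then show ?case using x0 by simp
  next
    case (Suc n)
    define a where "a = gain l q (T - Suc n)"
    define y where "y = x (Suc n) - v (Suc n)"
    define z where "z = x n - v (Suc n)"
    define d where "d = v (Suc n) - v n"
    have Tn: "T - n = Suc (T - Suc n)" using Suc.prems by simp
    have a: "0 \<le> a" unfolding a_def by (rule gain_nonneg[OF l q])
    have g: "gain l q (T - n) = 1 - 1 / (1 + l + a)"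
      by (simp add: Tn a_def)
    \<comment> \<open>With \<open>c = 1 + l + a\<close>, completing the square in \<open>y\<close>
      gives \<open>l * y^2 + (y - z)^2 + a * y^2 = c * (y - z / c)^2 + (1 - 1 / c) * z^2\<close>.
      Then \<open>z^2 = d^2 - 2 * (z + d) * d + (z + d)^2\<close> isolates the increment
      \<open>d\<close>; the last square is the remainder left by the previous round.\<close>
    have *: "(l * y\<^sup>2 + (y - z)\<^sup>2) / 2 =
       (1 - 1 / (1 + l + a)) * (d\<^sup>2 / 2 - (z + d) * d)
       + (1 + l + a) / 2 * (y - z / (1 + l + a))\<^sup>2
       + (1 - 1 / (1 + l + a)) * (z + d)\<^sup>2 / 2 - a * y\<^sup>2 / 2"
    proof -
      define c where "c = 1 + l + a"
      have c: "c \<noteq> 0" and l': "l = c - 1 - a" using l a by (auto simp: c_def)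
      show ?thesis
        unfolding c_def[symmetric] l' using c
        by (simp add: field_simps power2_eq_square)
    qed
    have e: "x (Suc n) - x n = y - z" "x n - v n = z + d" by (auto simp: y_def z_def d_def)
    show ?case
      using Suc.IH Suc.prems * by (simp add: e g y_def[symmetric] z_def[symmetric] d_def[symmetric] a_def[symmetric])
        (simp add: add_divide_distrib diff_divide_distrib)
  qed
  from this[of T] show ?thesis by (simp add: scalar_cost_def)
qed

text \<open>The potential is \<open>(1 + l + gain l q (T - t)) / 2 * (x t - y t)\<^sup>2\<close>: strong convexity of the
  objective minimised by \<open>x t\<close> produces it, and it pays for replacing \<open>x (t - 1)\<close> by \<open>y (t - 1)\<close>.\<close>
lemma scalar_competitive:
  assumes l: "0 < l" and q: "0 \<le> q" and fp: "q\<^sup>2 + l * q \<le> l"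
    and x0: "x 0 = y 0"
    and step: "\<And>t. t \<in> {1..T} \<Longrightarrow> x t - v t = (x (t - 1) - v t) / (1 + l + gain l q (T - t))"
  shows "scalar_cost l T v x \<le> (1 + 1 / (l + q)) * scalar_cost l T v y"
proof -
  have "n \<le> T \<Longrightarrow> (\<Sum>t = 1..n. (l * (x t - v t)\<^sup>2 + (x t - x (t - 1))\<^sup>2) / 2)
      + (1 + l + gain l q (T - n)) / 2 * (x n - y n)\<^sup>2
      \<le> (1 + 1 / (l + q)) * (\<Sum>t = 1..n. (l * (y t - v t)\<^sup>2 + (y t - y (t - 1))\<^sup>2) / 2)" for n
  proof (induction n)
    case 0
    then show ?case using x0 by simp
  next
    case (Suc n)
    define a where "a = gain l q (T - Suc n)"
    define b where "b = gain l q (T - n)"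
    define X where "X = x (Suc n) - v (Suc n)"
    define Y where "Y = y (Suc n) - v (Suc n)"
    define z where "z = x n - v (Suc n)"
    define w where "w = y (Suc n) - y n"
    define D where "D = y n - x n"
    have a: "q \<le> a" "a\<^sup>2 + l * a \<le> l" and b: "q \<le> b"
      using gain_bounds[OF l q fp] by (auto simp: a_def b_def)
    have X: "X = z / (1 + l + a)"
      using step[of "Suc n"] Suc.prems by (simp add: X_def z_def a_def)
    \<comment> \<open>\<open>X\<close> minimises the quadratic
      \<open>l * Y^2 + (Y - z)^2 + a * Y^2\<close>, whose leading coefficient is
      \<open>1 + l + a\<close>; hence its value at \<open>Y\<close> exceeds the minimum by exactly
      \<open>(1 + l + a) * (X - Y)^2\<close>. Here \<open>Y - z = w + D\<close>.\<close>
    have opt: "l * X\<^sup>2 + (X - z)\<^sup>2 + a * X\<^sup>2 + (1 + l + a) * (X - Y)\<^sup>2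
        = l * Y\<^sup>2 + (w + D)\<^sup>2 + a * Y\<^sup>2"
    proof -
      define c where "c = 1 + l + a"
      have c: "c \<noteq> 0" and l': "l = c - 1 - a" using l a q by (auto simp: c_def)
      have wD: "w + D = Y - z" by (simp add: w_def D_def Y_def z_def)
      show ?thesis
        unfolding X c_def[symmetric] wD l' using c
        by (simp add: field_simps power2_eq_square)
    qed
    \<comment> \<open>The extra term \<open>a * Y^2\<close> is charged to the hitting cost of the
      comparison sequence. This is where staying below the fixed point is used.\<close>
    have "a * (l + q) \<le> a * (l + a)" using a q by (intro mult_left_mono) auto
    also have "\<dots> \<le> l" using a by (simp add: power2_eq_square algebra_simps)
    finally have "a \<le> 1 / (l + q) * l" using l q by (simp add: field_simps)
    then have hit: "a * Y\<^sup>2 \<le> 1 / (l + q) * l * Y\<^sup>2"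
      by (rule mult_right_mono) simp
    \<comment> \<open>Young's inequality, with the parameter \<open>l + b\<close> chosen so that the
      coefficient of \<open>D^2\<close> is the potential before the round. The factor left on
      \<open>w^2\<close> is controlled by \<open>q \<le> b\<close>.\<close>
    have "(w + D)\<^sup>2 \<le> (1 + 1 / (l + b)) * w\<^sup>2 + (1 + l + b) * D\<^sup>2"
    proof -
      define m where "m = l + b"
      have m: "0 < m" using l q b by (simp add: m_def)
      have "(1 + 1 / m) * w\<^sup>2 + (1 + m) * D\<^sup>2 - (w + D)\<^sup>2 = (w - m * D)\<^sup>2 / m"
        using m by (simp add: field_simps power2_eq_square)
      also have "\<dots> \<ge> 0" using m by simp
      finally show ?thesis by (simp add: m_def add.assoc)
    qed
    also have "(1 + 1 / (l + b)) * w\<^sup>2 \<le> (1 + 1 / (l + q)) * w\<^sup>2"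
      using l q b by (intro mult_right_mono add_left_mono divide_left_mono) auto
    finally have "(w + D)\<^sup>2 \<le> (1 + 1 / (l + q)) * w\<^sup>2 + (1 + l + b) * D\<^sup>2" by simp
    moreover have "0 \<le> a * X\<^sup>2" using a q by simp
    moreover have "(1 + 1 / (l + q)) * (l * Y\<^sup>2) = l * Y\<^sup>2 + 1 / (l + q) * l * Y\<^sup>2"
      by (simp add: algebra_simps)
    ultimately have "l * X\<^sup>2 + (X - z)\<^sup>2 + (1 + l + a) * (X - Y)\<^sup>2
        \<le> (1 + 1 / (l + q)) * (l * Y\<^sup>2) + (1 + 1 / (l + q)) * w\<^sup>2 + (1 + l + b) * D\<^sup>2"
      using opt hit by linarith
    \<comment> \<open>The instantiation divides by 2.\<close>
    from divide_right_mono[OF this zero_le_numeral, of "num.Bit0 num.One"]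
    have "(l * X\<^sup>2 + (X - z)\<^sup>2) / 2 + (1 + l + a) / 2 * (X - Y)\<^sup>2
        \<le> (1 + 1 / (l + q)) * ((l * Y\<^sup>2 + w\<^sup>2) / 2) + (1 + l + b) / 2 * D\<^sup>2"
      unfolding times_divide_eq_left times_divide_eq_right distrib_left[of "1 + 1 / (l + q)"]
      by (simp only: add_divide_distrib)
    moreover have "x (Suc n) - y (Suc n) = X - Y" "x (Suc n) - x n = X - z" "(x n - y n)\<^sup>2 = D\<^sup>2"
      by (auto simp: X_def Y_def z_def D_def power2_commute)
    ultimately show ?case
      using Suc.IH Suc.prems
      by (simp add: X_def[symmetric] Y_def[symmetric] w_def[symmetric] a_def[symmetric]
          b_def[symmetric] distrib_left[of "1 + 1 / (l + q)"])
  qed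
  from this[of T] have "scalar_cost l T v x + (1 + l + gain l q 0) / 2 * (x T - y T)\<^sup>2
      \<le> (1 + 1 / (l + q)) * scalar_cost l T v y"
    by (simp add: scalar_cost_def)
  moreover have "0 \<le> (1 + l + gain l q 0) / 2 * (x T - y T)\<^sup>2" using l q by simp
  ultimately show ?thesis by linarith
qed

section \<open>Diagonalisation\<close>

text \<open>Throughout, \<open>x v* P\<close> equals \<open>transpose P *v x\<close>, the
  coordinates of \<open>x\<close> with respect to the columns of \<open>P\<close>, that is, an
  eigenbasis of \<open>A\<close>.\<close>

lemma inner_orthogonal_coords:
  fixes P :: "real^'n^'n"
  assumes "orthogonal_matrix P"
  shows "(x v* P) \<bullet> (y v* P) = x \<bullet> y"
proof -
  have "(x v* P) \<bullet> (y v* P) = x \<bullet> (P *v (transpose P *v y))"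
    by (simp add: dot_lmul_matrix)
  also have "\<dots> = x \<bullet> y"
    using assms unfolding matrix_vector_mul_assoc orthogonal_matrix_def by simp
  finally show ?thesis .
qed

lemma diag_matrix_mult_vec: "(diag_matrix l *v x) $ i = l i * x $ i"
  by (simp add: diag_matrix_def matrix_vector_mult_def if_distrib[of "\<lambda>c. c * _"] cong: if_cong)

lemma conj_diag_mult_vec:
  fixes P :: "real^'n^'n"
  assumes "orthogonal_matrix P"
  shows "(((P ** diag_matrix l ** transpose P) *v x) v* P) $ i = l i * (x v* P) $ i"
proof -
  have "((P ** diag_matrix l ** transpose P) *v x) v* P
      = transpose P *v ((P ** diag_matrix l ** transpose P) *v x)" by simp
  also have "\<dots> = (transpose P ** P) *v (diag_matrix l *v (transpose P *v x))"
    by (simp only: matrix_vector_mul_assoc matrix_mul_assoc)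
  also have "\<dots> = diag_matrix l *v (x v* P)"
    using assms by (simp add: orthogonal_matrix_def)
  finally show ?thesis by (simp add: diag_matrix_mult_vec)
qed

lemma orthogonal_coords_eq_iff:
  fixes P :: "real^'n^'n"
  assumes "orthogonal_matrix P"
  shows "x = y \<longleftrightarrow> (\<forall>i. (x v* P) $ i = (y v* P) $ i)"
proof -
  have "x = P *v (x v* P)" for x
    using assms unfolding transpose_matrix_vector[symmetric] matrix_vector_mul_assoc
    by (simp add: orthogonal_matrix_def)
  then show ?thesis by (metis vec_eq_iff)
qed

lemma scalar_cost_nonneg: "0 \<le> l \<Longrightarrow> 0 \<le> scalar_cost l T v x"
  unfolding scalar_cost_def by (intro sum_nonneg) auto

text \<open>Supplies the dominating function that makes squared deviations integrable when the cost
  is.\<close>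

lemma scalar_cost_ge_term:
  assumes "0 \<le> l" "t \<in> {1..T}"
  shows "l / 2 * (x t - v t)\<^sup>2 \<le> scalar_cost l T v x"
proof -
  have "l / 2 * (x t - v t)\<^sup>2 \<le> (l * (x t - v t)\<^sup>2 + (x t - x (t - 1))\<^sup>2) / 2" by simp
  also have "\<dots> \<le> scalar_cost l T v x"
    unfolding scalar_cost_def using assms by (intro member_le_sum) auto
  finally show ?thesis .
qed

text \<open>Rotation preserves the movement norm and diagonalises the hitting cost, so distinct
  coordinates do not interact.\<close>

lemma total_cost_coords:
  fixes P :: "real^'n^'n"
  assumes P: "orthogonal_matrix P" and A: "A = P ** diag_matrix l ** transpose P"
  shows "total_cost A T v x
    = (\<Sum>i\<in>UNIV. scalar_cost (l i) T (\<lambda>t. (v t v* P) $ i) (\<lambda>t. (x t v* P) $ i))"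
proof -
  have hit: "hitting_cost A (v t) (x t)
      = (\<Sum>i\<in>UNIV. l i * ((x t v* P) $ i - (v t v* P) $ i)\<^sup>2 / 2)" for t
  proof -
    have "(x t - v t) \<bullet> (A *v (x t - v t)) = ((x t - v t) v* P) \<bullet> ((A *v (x t - v t)) v* P)"
      by (simp add: inner_orthogonal_coords[OF P])
    then show ?thesis
      unfolding hitting_cost_def inner_vec_def A conj_diag_mult_vec[OF P]
      by (simp add: sum_divide_distrib vector_matrix_mult_diff_distrib power2_eq_square algebra_simps)
  qed
  have mov: "(norm (x t - x s))\<^sup>2 = (\<Sum>i\<in>UNIV. ((x t v* P) $ i - (x s v* P) $ i)\<^sup>2)" for t s
  proof -
    have "(norm (x t - x s))\<^sup>2 = ((x t - x s) v* P) \<bullet> ((x t - x s) v* P)"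
      by (simp add: inner_orthogonal_coords[OF P] power2_norm_eq_inner)
    then show ?thesis
      by (simp add: inner_vec_def vector_matrix_mult_diff_distrib power2_eq_square)
  qed
  show ?thesis
    unfolding total_cost_def scalar_cost_def hit mov
    by (subst sum.swap) (simp add: sum_divide_distrib sum.distrib[symmetric] add_divide_distrib)
qed

text \<open>Ties \<open>lambda_min\<close>, defined through the spectrum, to the given entries of
  \<open>l\<close>. A nonzero coordinate of an eigenvector identifies its eigenvalue; conversely the
  columns of \<open>P\<close> are eigenvectors.\<close>

lemma eigenvalues_conj_diag:
  fixes P :: "real^'n^'n"
  assumes P: "orthogonal_matrix P" and A: "A = P ** diag_matrix l ** transpose P"
  shows "eigenvalues A = range l"
proof (intro equalityI subsetI)
  fix m assume "m \<in> eigenvalues A"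
  then obtain x where x: "x \<noteq> 0" "A *v x = m *\<^sub>R x" by (auto simp: eigenvalues_def)
  then obtain i where i: "(x v* P) $ i \<noteq> 0"
    using orthogonal_coords_eq_iff[OF P, of x 0] by auto
  have "l i * (x v* P) $ i = m * (x v* P) $ i"
    using conj_diag_mult_vec[OF P, of l x i] x(2) unfolding A[symmetric]
    by (simp add: vector_matrix_mult_def sum_distrib_left mult_ac)
  with i have "m = l i" by simp
  then show "m \<in> range l" by blast
next
  fix m assume "m \<in> range l"
  then obtain i where m: "m = l i" by auto
  define x where "x = P *v axis i 1"
  have xP: "x v* P = axis i 1"
    using P unfolding x_def transpose_matrix_vector[symmetric] matrix_vector_mul_assoc
    by (simp add: orthogonal_matrix_def)
  have "x \<noteq> 0" using xP by (metis axis_eq_0_iff vector_matrix_mult_0 zero_neq_one)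
  moreover have "A *v x = m *\<^sub>R x"
    unfolding orthogonal_coords_eq_iff[OF P] A conj_diag_mult_vec[OF P]
    by (simp add: xP m axis_def scaleR_vector_matrix_assoc)
  ultimately show "m \<in> eigenvalues A" by (auto simp: eigenvalues_def)
qed

section \<open>The algorithm in the eigenbasis\<close>

lemma matrix_inv_eq:
  fixes A B :: "real^'n^'n"
  assumes "A ** B = mat 1"
  shows "matrix_inv A = B"
proof -
  have "B ** A = mat 1" using assms matrix_left_right_inverse by blast
  have "invertible A" using assms \<open>B ** A = mat 1\<close> by (auto simp: invertible_def)
  then have "matrix_inv A ** A = mat 1"
    unfolding invertible_def matrix_inv_def by (rule someI2_ex) simp
  then show ?thesis using assms by (metis matrix_mul_assoc matrix_mul_lid matrix_mul_rid)
qed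

text \<open>All matrices of the recursion are diagonal in the same basis. On an eigenvalue,
  \<open>2 + l - 1 / (1 + l + a) = 1 + l + (1 - 1 / (1 + l + a))\<close>, so inverting reproduces
  the form \<open>1 / (1 + l + a')\<close> with \<open>a'\<close> the next value of
  \<open>gain\<close>.\<close>

lemma lai_back_coords:
  fixes P :: "real^'n^'n"
  assumes P: "orthogonal_matrix P" and A: "A = P ** diag_matrix l ** transpose P"
    and l: "\<And>i. 0 < l i" and q: "\<And>i. 0 \<le> q i"
    and end_eig: "\<And>i. lai_terminal_eig \<gamma> (l i) = 1 / (1 + l i + q i)"
  shows "lai_back P l A \<gamma> k
    = P ** diag_matrix (\<lambda>i. 1 / (1 + l i + gain (l i) (q i) k)) ** transpose P"
proof (induction k)
  case 0
  then show ?case by (simp add: end_eig)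
next
  case (Suc k)
  let ?c = "\<lambda>i. 1 / (1 + l i + gain (l i) (q i) k)"
  let ?c' = "\<lambda>i. 1 / (1 + l i + gain (l i) (q i) (Suc k))"
  have "(mat 2 + A - lai_back P l A \<gamma> k) ** (P ** diag_matrix ?c' ** transpose P) = mat 1"
  proof -
    have g: "1 + l i + gain (l i) (q i) (Suc k) \<noteq> 0" for i
      using gain_nonneg[OF l q, of i i "Suc k"] l[of i] by linarith
    have g': "2 + l i - ?c i = 1 + l i + gain (l i) (q i) (Suc k)" for i by simp
    have two: "mat 2 *v x = 2 *\<^sub>R x" for x :: "real^'n"
      by (simp add: mat_def matrix_vector_mult_def vec_eq_iff if_distrib[of "\<lambda>c. c * _"] cong: if_cong)
    have "((((mat 2 + A - lai_back P l A \<gamma> k) ** (P ** diag_matrix ?c' ** transpose P)) *v x) v* P) $ i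
        = (x v* P) $ i" for x i
    proof -
      define y where "y = (P ** diag_matrix ?c' ** transpose P) *v x"
      have y: "(y v* P) $ i = ?c' i * (x v* P) $ i"
        unfolding y_def by (rule conj_diag_mult_vec[OF P])
      have "(((mat 2 + A - lai_back P l A \<gamma> k) *v y) v* P) $ i
          = 2 * (y v* P) $ i + l i * (y v* P) $ i - ?c i * (y v* P) $ i"
        unfolding Suc matrix_vector_mult_diff_rdistrib matrix_vector_mult_add_rdistrib two
          vector_matrix_mult_diff_distrib vector_matrix_left_distrib
        using conj_diag_mult_vec[OF P, of ?c y i] conj_diag_mult_vec[OF P, of l y i, folded A]
        by (simp add: scaleR_vector_matrix_assoc)
      also have "\<dots> = (2 + l i - ?c i) * (y v* P) $ i" by (simp only: algebra_simps)
      also have "\<dots> = (x v* P) $ i"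
        unfolding g' y using g by simp
      finally show ?thesis by (simp only: y_def matrix_vector_mul_assoc)
    qed
    then show ?thesis
      unfolding matrix_eq orthogonal_coords_eq_iff[OF P] by simp
  qed
  then show ?case unfolding lai_back.simps by (rule matrix_inv_eq)
qed

text \<open>The update says that the deviation from \<open>v t\<close> is \<open>lai_C\<close>
  applied to the previous point's deviation from the same \<open>v t\<close>.\<close>

lemma lai_coords:
  fixes P :: "real^'n^'n"
  assumes P: "orthogonal_matrix P" and A: "A = P ** diag_matrix l ** transpose P"
    and l: "\<And>i. 0 < l i" and q: "\<And>i. 0 \<le> q i"
    and end_eig: "\<And>i. lai_terminal_eig \<gamma> (l i) = 1 / (1 + l i + q i)"
    and t: "t \<in> {1..T}"
  shows "(lai P l A \<gamma> T x0 v t v* P) $ i - (v t v* P) $ i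
    = ((lai P l A \<gamma> T x0 v (t - 1) v* P) $ i - (v t v* P) $ i)
        / (1 + l i + gain (l i) (q i) (T - t))"
proof -
  define y where "y = lai P l A \<gamma> T x0 v (t - 1)"
  define C where "C = lai_C P l A \<gamma> T t"
  obtain s where s: "t = Suc s" using t by (cases t) auto
  have C: "((C *v x) v* P) $ i = (x v* P) $ i / (1 + l i + gain (l i) (q i) (T - t))" for x
    unfolding C_def lai_C_def lai_back_coords[OF P A l q end_eig] conj_diag_mult_vec[OF P] by simp
  have "lai P l A \<gamma> T x0 v t - v t = C *v (y - v t)"
    by (simp add: s y_def C_def matrix_vector_mult_diff_rdistrib matrix_vector_mult_diff_distrib)
  then have "((lai P l A \<gamma> T x0 v t - v t) v* P) $ i = ((C *v (y - v t)) v* P) $ i" by simp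
  then show ?thesis unfolding C by (simp add: vector_matrix_mult_diff_distrib y_def)
qed

section \<open>The terminal weight of LAI\<close>

definition terminal_weight :: "real \<Rightarrow> real \<Rightarrow> real" where
  "terminal_weight \<gamma> l = l / 2 * ((1 + 4 / l) powr (\<gamma> / 2) - 1)"

lemma terminal_weight_nonneg:
  assumes "0 < l" "0 \<le> \<gamma>"
  shows "0 \<le> terminal_weight \<gamma> l"
  unfolding terminal_weight_def
  using assms by (intro mult_nonneg_nonneg) (auto intro!: ge_one_powr_ge_zero)

lemma lai_terminal_eig_eq: "lai_terminal_eig \<gamma> l = 1 / (1 + l + terminal_weight \<gamma> l)"
  by (simp add: lai_terminal_eig_def terminal_weight_def inverse_eq_divide)

text \<open>Equality at \<open>\<gamma> = 1\<close> is the stationarity condition of the recursion for \<^const>\<open>gain\<close>.\<close>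
lemma terminal_weight_le:
  assumes l: "0 < l" and "0 \<le> \<gamma>" "\<gamma> \<le> 1"
  shows "(terminal_weight \<gamma> l)\<^sup>2 + l * terminal_weight \<gamma> l \<le> l"
proof -
  define s where "s = (1 + 4 / l) powr (\<gamma> / 2)"
  have "s\<^sup>2 = (1 + 4 / l) powr \<gamma>"
    using l by (simp add: s_def powr_power[symmetric] power2_eq_square powr_add[symmetric])
  also have "\<dots> \<le> (1 + 4 / l) powr 1"
    using assms by (intro powr_mono) auto
  finally have "s\<^sup>2 \<le> 1 + 4 / l" using l by (simp add: add_pos_pos)
  then have "l\<^sup>2 / 4 * (s\<^sup>2 - 1) \<le> l\<^sup>2 / 4 * (4 / l)"
    by (intro mult_left_mono) auto
  moreover have "l\<^sup>2 / 4 * (4 / l) = l" using l by (simp add: power2_eq_square)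
  \<comment> \<open>The weight is \<open>l * s / 2 - l / 2\<close>, so this is a difference of two
    squares.\<close>
  moreover have "(terminal_weight \<gamma> l)\<^sup>2 + l * terminal_weight \<gamma> l = l\<^sup>2 / 4 * (s\<^sup>2 - 1)"
    unfolding terminal_weight_def s_def[symmetric] by (simp add: power2_eq_square field_simps)
  ultimately show ?thesis by linarith
qed

lemma inverse_terminal_weight:
  assumes l: "0 < l"
  shows "1 / (l + terminal_weight \<gamma> l) = 2 / l * inverse ((1 + 4 / l) powr (\<gamma> / 2) + 1)"
proof -
  have "l + terminal_weight \<gamma> l = l * ((1 + 4 / l) powr (\<gamma> / 2) + 1) / 2"
    by (simp add: terminal_weight_def algebra_simps)
  then show ?thesis by (simp only: inverse_eq_divide) simp
qed

text \<open>Clearing the quotient inside the power gives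
  \<open>l powr (1 - \<gamma> / 2) * (l + 4) powr (\<gamma> / 2)\<close>, a product of increasing
  functions because both exponents are nonnegative.\<close>

lemma add_terminal_weight_mono:
  assumes m: "0 < m" "m \<le> l" and g: "0 \<le> \<gamma>" "\<gamma> \<le> 1"
  shows "m + terminal_weight \<gamma> m \<le> l + terminal_weight \<gamma> l"
proof -
  have eq: "l + terminal_weight \<gamma> l = (l + l powr (1 - \<gamma> / 2) * (l + 4) powr (\<gamma> / 2)) / 2"
    if "0 < l" for l
  proof -
    have "1 + 4 / l = (l + 4) / l" using that by (simp add: field_simps)
    then have "l * (1 + 4 / l) powr (\<gamma> / 2) = l powr (1 - \<gamma> / 2) * (l + 4) powr (\<gamma> / 2)"
      using that by (simp add: powr_divide powr_diff)
    then show ?thesis by (simp add: terminal_weight_def algebra_simps)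
  qed
  have "m powr (1 - \<gamma> / 2) * (m + 4) powr (\<gamma> / 2) \<le> l powr (1 - \<gamma> / 2) * (l + 4) powr (\<gamma> / 2)"
    using m g by (intro mult_mono powr_mono2) auto
  then show ?thesis using m by (simp add: eq)
qed

text \<open>The factor \<open>l\<close> of the weight cancels; what remains has a nonnegative
  numerator decreasing in \<open>l\<close> and a positive denominator increasing in
  \<open>l\<close>. Thus the regret bound is also worst at the smallest eigenvalue.\<close>

lemma terminal_weight_quotient_antimono:
  assumes m: "0 < m" "m \<le> l" and g: "0 \<le> \<gamma>"
  shows "terminal_weight \<gamma> l / (l * (l + 2))
    \<le> ((1 + 4 / m) powr (\<gamma> / 2) - 1) / (m + 2) / 2"
proof -
  have "terminal_weight \<gamma> l / (l * (l + 2)) = ((1 + 4 / l) powr (\<gamma> / 2) - 1) / (l + 2) / 2"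
    using m by (simp add: terminal_weight_def)
  also have "\<dots> \<le> ((1 + 4 / m) powr (\<gamma> / 2) - 1) / (m + 2) / 2"
  proof (intro divide_right_mono frac_le)
    have "4 / l \<le> 4 / m" using m by (intro divide_left_mono) auto
    then have "(1 + 4 / l) powr (\<gamma> / 2) \<le> (1 + 4 / m) powr (\<gamma> / 2)"
      using m g by (intro powr_mono2) auto
    then show "(1 + 4 / l) powr (\<gamma> / 2) - 1 \<le> (1 + 4 / m) powr (\<gamma> / 2) - 1" by simp
    show "0 \<le> (1 + 4 / m) powr (\<gamma> / 2) - 1"
      using m g by (auto intro!: ge_one_powr_ge_zero)
  qed (use m in auto)
  finally show ?thesis .
qed

section \<open>Rotated martingale increments\<close>

text \<open>The diagonal entries of \<open>transpose P ** S ** P\<close>: the second moments of the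
  rotated increments when \<open>S\<close> is their covariance.\<close>

definition coord_var :: "real^'n^'n \<Rightarrow> real^'n^'n \<Rightarrow> 'n \<Rightarrow> real" where
  "coord_var P S i = (\<Sum>j\<in>UNIV. \<Sum>k\<in>UNIV. P $ j $ i * P $ k $ i * S $ j $ k)"

text \<open>The trace is invariant under rotation: the rows of \<open>P\<close> are orthonormal, so
  only the diagonal of \<open>S\<close> survives.\<close>

lemma sum_coord_var:
  fixes P :: "real^'n^'n"
  assumes "orthogonal_matrix P"
  shows "(\<Sum>i\<in>UNIV. coord_var P S i) = trace S"
proof -
  have PP: "(\<Sum>i\<in>UNIV. P $ j $ i * P $ k $ i) = (if j = k then 1 else 0)" for j k
  proof -
    have "(P ** transpose P) $ j $ k = (mat 1 :: real^'n^'n) $ j $ k"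
      using assms by (simp add: orthogonal_matrix_def)
    then show ?thesis by (simp add: matrix_matrix_mult_def transpose_def mat_def)
  qed
  have "(\<Sum>i\<in>UNIV. coord_var P S i)
      = (\<Sum>j\<in>UNIV. \<Sum>k\<in>UNIV. (\<Sum>i\<in>UNIV. P $ j $ i * P $ k $ i) * S $ j $ k)"
    unfolding coord_var_def sum_distrib_right
    by (subst sum.swap, rule sum.cong[OF refl], rule sum.swap)
  then show ?thesis by (simp add: PP trace_def if_distrib[of "\<lambda>c. c * _"] cong: if_cong)
qed

lemma coord_nth: "(x v* P) $ i = (\<Sum>j\<in>UNIV. P $ j $ i * x $ j)" for P :: "real^'m^'n"
  by (simp add: vector_matrix_mult_def mult.commute)

lemma borel_measurable_nth_cart:
  fixes f :: "'a \<Rightarrow> real^'n"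
  assumes "f \<in> borel_measurable F"
  shows "(\<lambda>\<omega>. f \<omega> $ i) \<in> borel_measurable F"
  using assms by (rule measurable_compose) (intro borel_measurable_continuous_onI continuous_intros)

lemma borel_measurable_coord:
  fixes P :: "real^'n^'n"
  assumes "f \<in> borel_measurable F"
  shows "(\<lambda>\<omega>. (f \<omega> v* P) $ i) \<in> borel_measurable F"
  unfolding coord_nth
  by (intro borel_measurable_sum borel_measurable_times borel_measurable_const
      borel_measurable_nth_cart assms)

lemma integrable_mult_of_squares:
  fixes f g :: "'a \<Rightarrow> real"
  assumes [measurable]: "f \<in> borel_measurable M" "g \<in> borel_measurable M"
    and "integrable M (\<lambda>\<omega>. (f \<omega>)\<^sup>2)" "integrable M (\<lambda>\<omega>. (g \<omega>)\<^sup>2)"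
  shows "integrable M (\<lambda>\<omega>. f \<omega> * g \<omega>)"
proof (rule Bochner_Integration.integrable_bound)
  show "integrable M (\<lambda>\<omega>. (f \<omega>)\<^sup>2 + (g \<omega>)\<^sup>2)"
    using assms by simp
  show "AE \<omega> in M. norm (f \<omega> * g \<omega>) \<le> norm ((f \<omega>)\<^sup>2 + (g \<omega>)\<^sup>2)"
  proof (rule AE_I2)
    fix \<omega>
    have "2 * (\<bar>f \<omega>\<bar> * \<bar>g \<omega>\<bar>) \<le> (f \<omega>)\<^sup>2 + (g \<omega>)\<^sup>2"
      using zero_le_power2[of "\<bar>f \<omega>\<bar> - \<bar>g \<omega>\<bar>"]
      by (simp add: power2_diff)
    moreover have "0 \<le> \<bar>f \<omega>\<bar> * \<bar>g \<omega>\<bar>" by simp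
    ultimately have "\<bar>f \<omega>\<bar> * \<bar>g \<omega>\<bar> \<le> (f \<omega>)\<^sup>2 + (g \<omega>)\<^sup>2" by linarith
    then show "norm (f \<omega> * g \<omega>) \<le> norm ((f \<omega>)\<^sup>2 + (g \<omega>)\<^sup>2)"
      by (simp add: abs_mult)
  qed
qed measurable

text \<open>The lower bound obtained for the cost may be negative at some outcomes, where
  \<open>ennreal\<close> truncates to 0; passing to the positive part only raises the integral of
  \<open>f\<close>.\<close>

lemma has_bochner_integral_le_nn_integral:
  fixes f g :: "'a \<Rightarrow> real"
  assumes f: "has_bochner_integral M f r" and fg: "\<And>\<omega>. \<omega> \<in> space M \<Longrightarrow> f \<omega> \<le> g \<omega>"
  shows "ennreal r \<le> (\<integral>\<^sup>+ \<omega>. ennreal (g \<omega>) \<partial>M)"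
proof -
  have int: "integrable M f" "r = (\<integral>\<omega>. f \<omega> \<partial>M)"
    using f by (auto simp: has_bochner_integral_iff)
  have int': "integrable M (\<lambda>\<omega>. max 0 (f \<omega>))" using int by simp
  have "r \<le> (\<integral>\<omega>. max 0 (f \<omega>) \<partial>M)"
    unfolding int(2) by (intro integral_mono int int') simp
  then have "ennreal r \<le> ennreal (\<integral>\<omega>. max 0 (f \<omega>) \<partial>M)" by (rule ennreal_leI)
  also have "\<dots> = (\<integral>\<^sup>+ \<omega>. ennreal (max 0 (f \<omega>)) \<partial>M)"
    using int' by (intro nn_integral_eq_integral[symmetric]) auto
  also have "\<dots> \<le> (\<integral>\<^sup>+ \<omega>. ennreal (g \<omega>) \<partial>M)"
    by (intro nn_integral_mono) (auto simp: max_def intro: ennreal_leI fg)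
  finally show ?thesis .
qed

section \<open>Expected costs in the martingale setting\<close>

locale martingale_setting = prob_space M for M :: "'a measure" +
  fixes T :: nat and x0 :: "real^'n" and v :: "nat \<Rightarrow> 'a \<Rightarrow> real^'n" and S :: "real^'n^'n"
  assumes martingale: "martingale_minimizers M T x0 v"
    and covariance: "increments_covariance M T v S"
begin

abbreviation incr :: "nat \<Rightarrow> 'a \<Rightarrow> real^'n" where
  "incr t \<omega> \<equiv> v t \<omega> - v (t - 1) \<omega>"

lemma v_0: "\<omega> \<in> space M \<Longrightarrow> v 0 \<omega> = x0"
  using martingale by (simp add: martingale_minimizers_def)

lemma integrable_v: "t \<le> T \<Longrightarrow> integrable M (v t)"
proof (cases "t = 0")
  case True
  have "integrable M (v 0) \<longleftrightarrow> integrable M (\<lambda>_. x0)"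
    by (rule Bochner_Integration.integrable_cong) (auto simp: v_0)
  with True show ?thesis by simp
next
  case False
  moreover assume "t \<le> T"
  ultimately show ?thesis using martingale by (simp add: martingale_minimizers_def)
qed

lemma space_nat_filt [simp]: "space (nat_filt M v t) = space M"
  by (simp add: nat_filt_def space_measure_of_conv)

lemma sets_nat_filt:
  "sets (nat_filt M v t)
    = sigma_sets (space M) (\<Union>s\<in>{1..t}. {v s -` B \<inter> space M | B. B \<in> sets borel})"
  unfolding nat_filt_def by (rule sets_measure_of) auto

lemma sets_nat_filt_mono: "s \<le> t \<Longrightarrow> sets (nat_filt M v s) \<subseteq> sets (nat_filt M v t)"
  unfolding sets_nat_filt by (intro sigma_sets_mono' UN_mono) auto

lemma subalgebra_nat_filt:
  assumes "t \<le> T"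
  shows "subalgebra M (nat_filt M v t)"
proof -
  have "v s -` B \<inter> space M \<in> sets M" if "s \<in> {1..t}" "B \<in> sets borel" for s B
    using borel_measurable_integrable[OF integrable_v[of s]] that assms
    by (auto intro: measurable_sets)
  then show ?thesis
    unfolding subalgebra_def sets_nat_filt
    by (auto intro!: sets.sigma_sets_subset)
qed

lemma measurable_nat_filt_mono:
  assumes "f \<in> borel_measurable (nat_filt M v s)" "s \<le> t"
  shows "f \<in> borel_measurable (nat_filt M v t)"
  using measurable_mono[OF order_refl refl sets_nat_filt_mono[OF assms(2)]] assms(1) by auto

lemma measurable_nat_filt_M:
  assumes "f \<in> borel_measurable (nat_filt M v t)" "t \<le> T"
  shows "f \<in> borel_measurable M"
  using measurable_from_subalg[OF subalgebra_nat_filt[OF assms(2)] assms(1)] .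

text \<open>At \<open>t = 0\<close> the generating family is empty, and measurability comes from
  \<open>v 0\<close> being the constant \<open>x0\<close> on the space.\<close>

lemma adapted_v: "v t \<in> borel_measurable (nat_filt M v t)"
proof (cases "t = 0")
  case True
  have "v 0 \<in> borel_measurable (nat_filt M v t) \<longleftrightarrow> (\<lambda>_. x0) \<in> borel_measurable (nat_filt M v t)"
    by (rule measurable_cong) (simp add: v_0)
  with True show ?thesis by simp
next
  case False
  have "v t -` B \<inter> space M \<in> sets (nat_filt M v t)" if "B \<in> sets borel" for B
    unfolding sets_nat_filt using False that
    by (intro sigma_sets.Basic UN_I[of t] CollectI exI[of _ B]) auto
  then show ?thesis by (intro measurableI) auto
qed

lemma square_integrable_incr:
  assumes "t \<in> {1..T}"
  shows "integrable M (\<lambda>\<omega>. (incr t \<omega> $ i)\<^sup>2)"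
  using covariance assms
  by (auto simp: increments_covariance_def power2_eq_square has_bochner_integral_iff)

text \<open>The increment has conditional expectation zero given the past, hence so has its product
  with a factor known at time \<open>t - 1\<close>. Square integrability of both factors makes the
  product integrable.\<close>

lemma orthogonal_incr:
  assumes t: "t \<in> {1..T}" and f: "f \<in> borel_measurable (nat_filt M v (t - 1))"
    and f2: "integrable M (\<lambda>\<omega>. (f \<omega>)\<^sup>2)"
  shows "has_bochner_integral M (\<lambda>\<omega>. f \<omega> * incr t \<omega> $ i) 0"
proof -
  have tT: "t - 1 \<le> T" "t \<le> T" using t by auto
  interpret sigma_finite_subalgebra M "nat_filt M v (t - 1)"
    by (intro finite_measure_subalgebra_is_sigma_finite finite_measure_subalgebra.intro
        finite_measure_axioms finite_measure_subalgebra_axioms.intro subalgebra_nat_filt tT)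
  have vi: "integrable M (\<lambda>\<omega>. v s \<omega> $ i)" if "s \<le> T" for s
    by (rule integrable_bounded_linear[OF bounded_linear_vec_nth integrable_v[OF that]])
  have ce: "AE \<omega> in M. real_cond_exp M (nat_filt M v (t - 1)) (\<lambda>\<omega>. v s \<omega> $ i) \<omega> = v (t - 1) \<omega> $ i"
    if "t - 1 \<le> s" "s \<le> T" for s
    using martingale that by (simp add: martingale_minimizers_def)
  have "AE \<omega> in M. real_cond_exp M (nat_filt M v (t - 1)) (\<lambda>\<omega>. incr t \<omega> $ i) \<omega> = 0"
    using real_cond_exp_diff[OF vi[OF tT(2)] vi[OF tT(1)]] ce[of t] ce[of "t - 1"] tT
    by (auto simp: vector_minus_component)
  then have "(\<integral>\<omega>. f \<omega> * real_cond_exp M (nat_filt M v (t - 1)) (\<lambda>\<omega>. incr t \<omega> $ i) \<omega> \<partial>M)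
      = (\<integral>\<omega>. 0 \<partial>M)"
    using measurable_nat_filt_M[OF f tT(1)]
    by (intro integral_cong_AE) (auto intro: measurable_from_subalg[OF subalg])
  moreover have dm: "(\<lambda>\<omega>. incr t \<omega> $ i) \<in> borel_measurable M"
    using vi[OF tT(1)] vi[OF tT(2)] by (auto simp: vector_minus_component)
  moreover have "integrable M (\<lambda>\<omega>. f \<omega> * incr t \<omega> $ i)"
    by (rule integrable_mult_of_squares[OF measurable_nat_filt_M[OF f tT(1)] dm f2
          square_integrable_incr[OF t]])
  ultimately show ?thesis
    using real_cond_exp_intg(2)[of f "\<lambda>\<omega>. incr t \<omega> $ i"] f by (simp add: has_bochner_integral_iff)
qed

lemma orthogonal_incr_coord:
  assumes "t \<in> {1..T}" "f \<in> borel_measurable (nat_filt M v (t - 1))"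
    and "integrable M (\<lambda>\<omega>. (f \<omega>)\<^sup>2)"
  shows "has_bochner_integral M (\<lambda>\<omega>. f \<omega> * (incr t \<omega> v* P) $ i) 0"
proof -
  have "has_bochner_integral M (\<lambda>\<omega>. \<Sum>j\<in>UNIV. P $ j $ i * (f \<omega> * incr t \<omega> $ j))
      (\<Sum>j\<in>UNIV. P $ j $ i * 0)"
    by (intro has_bochner_integral_sum has_bochner_integral_mult_right orthogonal_incr assms)
  then show ?thesis by (simp add: coord_nth sum_distrib_left mult_ac)
qed

lemma has_integral_incr_coord:
  assumes "t \<in> {1..T}"
  shows "has_bochner_integral M (\<lambda>\<omega>. ((incr t \<omega> v* P) $ i)\<^sup>2) (coord_var P S i)"
proof -
  have "has_bochner_integral M
      (\<lambda>\<omega>. \<Sum>j\<in>UNIV. \<Sum>k\<in>UNIV. P $ j $ i * P $ k $ i * (incr t \<omega> $ j * incr t \<omega> $ k))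
      (coord_var P S i)"
    unfolding coord_var_def using covariance assms
    by (intro has_bochner_integral_sum has_bochner_integral_mult_right)
      (auto simp: increments_covariance_def)
  then show ?thesis
    by (simp add: coord_nth power2_eq_square sum_product mult_ac)
qed

text \<open>It is the second moment of the first rotated increment; \<open>1 \<le> T\<close> ensures
  that the covariance hypothesis covers this increment.\<close>

lemma coord_var_nonneg:
  assumes "1 \<le> T"
  shows "0 \<le> coord_var P S i"
proof -
  have "coord_var P S i = (\<integral>\<omega>. ((incr 1 \<omega> v* P) $ i)\<^sup>2 \<partial>M)"
    using has_integral_incr_coord[of 1 P i] assms
    by (simp add: has_bochner_integral_integral_eq)
  then show ?thesis by simp
qed

text \<open>The value does not depend on the deviations \<open>f\<close>, so the algorithm and every
  competing online strategy can be compared through the weights \<open>g\<close> alone. The product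
  at round \<open>t\<close> involves \<open>f (t - 1)\<close>, hence the range
  \<open>t < T\<close>.\<close>

lemma has_integral_weighted_incr:
  assumes adapted: "\<And>t. t < T \<Longrightarrow> f t \<in> borel_measurable (nat_filt M v t)"
    and sq: "\<And>t. t < T \<Longrightarrow> integrable M (\<lambda>\<omega>. (f t \<omega>)\<^sup>2)"
  shows "has_bochner_integral M
    (\<lambda>\<omega>. \<Sum>t = 1..T. g t * (((incr t \<omega> v* P) $ i)\<^sup>2 / 2 - f (t - 1) \<omega> * (incr t \<omega> v* P) $ i))
    (coord_var P S i / 2 * (\<Sum>t = 1..T. g t))"
proof -
  have "has_bochner_integral M
    (\<lambda>\<omega>. \<Sum>t = 1..T. g t * (((incr t \<omega> v* P) $ i)\<^sup>2 / 2 - f (t - 1) \<omega> * (incr t \<omega> v* P) $ i))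
    (\<Sum>t = 1..T. g t * (coord_var P S i / 2 - 0))"
    using assms
    by (intro has_bochner_integral_sum has_bochner_integral_mult_right has_bochner_integral_diff
        has_bochner_integral_divide_zero has_integral_incr_coord orthogonal_incr_coord) auto
  moreover have "(\<Sum>t = 1..T. g t * (coord_var P S i / 2 - 0)) = coord_var P S i / 2 * (\<Sum>t = 1..T. g t)"
    by (subst mult.commute, subst sum_distrib_right) simp
  ultimately show ?thesis by (simp only:)
qed

text \<open>A strategy of finite expected cost has square integrable deviations from the minimizers, as
  needed for the cross terms to have expectation zero.\<close>
lemma optimal_expected_cost_ge:
  fixes P A :: "real^'n^'n"
  assumes P: "orthogonal_matrix P" and A: "A = P ** diag_matrix l ** transpose P"
    and l: "\<And>i. 0 < l i"
  shows "ennreal (\<Sum>i\<in>UNIV. coord_var P S i / 2 * (\<Sum>t = 1..T. gain (l i) 0 (Suc T - t)))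
    \<le> optimal_expected_cost A T M x0 v"
  unfolding optimal_expected_cost_def
proof (rule INF_greatest)
  fix x assume x: "x \<in> online_strategies M T x0 v"
  define c where "c = (\<lambda>\<omega>. total_cost A T (\<lambda>t. v t \<omega>) (\<lambda>t. x t \<omega>))"
  define f where "f = (\<lambda>i t \<omega>. (x t \<omega> v* P) $ i - (v t \<omega> v* P) $ i)"
  have c_eq: "c \<omega> = (\<Sum>i\<in>UNIV. scalar_cost (l i) T (\<lambda>t. (v t \<omega> v* P) $ i) (\<lambda>t. (x t \<omega> v* P) $ i))" for \<omega>
    unfolding c_def by (rule total_cost_coords[OF P A])
  have x_0: "x 0 \<omega> = v 0 \<omega>" if "\<omega> \<in> space M" for \<omega>
    using x that v_0 by (simp add: online_strategies_def)
  have adapted_x: "x t \<in> borel_measurable (nat_filt M v t)" if "t \<le> T" for t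
  proof (cases "t = 0")
    case True
    have "x 0 \<in> borel_measurable (nat_filt M v 0) \<longleftrightarrow> v 0 \<in> borel_measurable (nat_filt M v 0)"
      by (rule measurable_cong) (simp add: x_0)
    with True adapted_v show ?thesis by simp
  qed (use x that in \<open>auto simp: online_strategies_def\<close>)
  have adapted_f: "f i t \<in> borel_measurable (nat_filt M v t)" if "t \<le> T" for i t
    unfolding f_def
    by (intro borel_measurable_diff borel_measurable_coord adapted_x adapted_v that)
  show "ennreal (\<Sum>i\<in>UNIV. coord_var P S i / 2 * (\<Sum>t = 1..T. gain (l i) 0 (Suc T - t)))
      \<le> expected_cost A T M v x"
  proof (cases "expected_cost A T M v x = \<infinity>")
    case False
    have "(\<lambda>\<omega>. (x t \<omega> v* P) $ i) \<in> borel_measurable M"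
      "(\<lambda>\<omega>. (v t \<omega> v* P) $ i) \<in> borel_measurable M" if "t \<le> T" for i t
      using that by (auto intro!: borel_measurable_coord measurable_nat_filt_M[OF adapted_x]
          measurable_nat_filt_M[OF adapted_v])
    then have "c \<in> borel_measurable M"
      unfolding c_eq[abs_def] scalar_cost_def
      by (intro borel_measurable_sum borel_measurable_divide borel_measurable_add borel_measurable_times
          borel_measurable_power borel_measurable_diff borel_measurable_const) auto
    moreover have c_nonneg: "0 \<le> c \<omega>" for \<omega>
      unfolding c_eq using l by (intro sum_nonneg scalar_cost_nonneg) (simp add: less_imp_le)
    moreover have "(\<integral>\<^sup>+ \<omega>. ennreal (c \<omega>) \<partial>M) < \<infinity>"
      using False by (simp add: expected_cost_def c_def top.not_eq_extremum)
    ultimately have c_int: "integrable M c" by (intro integrableI_nonneg) auto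
    \<comment> \<open>The deviation vanishes at time 0; later its square is at most
      \<open>2 / l i\<close> times the integrable cost.\<close>
    have sq: "integrable M (\<lambda>\<omega>. (f i t \<omega>)\<^sup>2)" if "t < T" for i t
    proof (cases "t = 0")
      case True
      have "integrable M (\<lambda>\<omega>. (f i 0 \<omega>)\<^sup>2) \<longleftrightarrow> integrable M (\<lambda>_. 0 :: real)"
        by (rule Bochner_Integration.integrable_cong) (auto simp: f_def x_0)
      with True show ?thesis by simp
    next
      case t: False
      show ?thesis
      proof (rule Bochner_Integration.integrable_bound)
        show "integrable M (\<lambda>\<omega>. 2 / l i * c \<omega>)" using c_int by simp
        show "(\<lambda>\<omega>. (f i t \<omega>)\<^sup>2) \<in> borel_measurable M"
          using measurable_nat_filt_M[OF adapted_f, of t] that by simp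
        show "AE \<omega> in M. norm ((f i t \<omega>)\<^sup>2) \<le> norm (2 / l i * c \<omega>)"
        proof (rule AE_I2)
          fix \<omega>
          have "l i / 2 * (f i t \<omega>)\<^sup>2
              \<le> scalar_cost (l i) T (\<lambda>t. (v t \<omega> v* P) $ i) (\<lambda>t. (x t \<omega> v* P) $ i)"
            unfolding f_def using l[of i] that t by (intro scalar_cost_ge_term) auto
          also have "\<dots> \<le> c \<omega>"
            unfolding c_eq using l
            by (intro member_le_sum scalar_cost_nonneg) (auto simp: less_imp_le)
          finally have "(f i t \<omega>)\<^sup>2 \<le> 2 / l i * c \<omega>"
            using l[of i] by (simp add: field_simps)
          then show "norm ((f i t \<omega>)\<^sup>2) \<le> norm (2 / l i * c \<omega>)"
            by (metis abs_ge_self abs_power2 order_trans real_norm_def)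
        qed
      qed
    qed
    define L where "L = (\<lambda>\<omega>. \<Sum>i\<in>UNIV. \<Sum>t = 1..T. gain (l i) 0 (Suc T - t)
        * (((incr t \<omega> v* P) $ i)\<^sup>2 / 2 - f i (t - 1) \<omega> * (incr t \<omega> v* P) $ i))"
    have "has_bochner_integral M L
        (\<Sum>i\<in>UNIV. coord_var P S i / 2 * (\<Sum>t = 1..T. gain (l i) 0 (Suc T - t)))"
      unfolding L_def
      by (intro has_bochner_integral_sum has_integral_weighted_incr adapted_f sq) auto
    \<comment> \<open>With terminal weight 0 the negative last term of
      \<open>scalar_cost_decomp\<close> disappears, and the dropped squares are nonnegative for
      every strategy.\<close>
    moreover have "L \<omega> \<le> c \<omega>" if "\<omega> \<in> space M" for \<omega>
      unfolding L_def c_eq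
    proof (rule sum_mono)
      fix i
      have "0 \<le> (\<Sum>t = 1..T. (1 + l i + gain (l i) 0 (T - t)) / 2 *
          ((x t \<omega> v* P) $ i - (v t \<omega> v* P) $ i
            - ((x (t - 1) \<omega> v* P) $ i - (v t \<omega> v* P) $ i) / (1 + l i + gain (l i) 0 (T - t)))\<^sup>2)"
        using l[of i] gain_nonneg[OF l[of i] order_refl]
        by (intro sum_nonneg mult_nonneg_nonneg) auto
      then show "(\<Sum>t = 1..T. gain (l i) 0 (Suc T - t)
          * (((incr t \<omega> v* P) $ i)\<^sup>2 / 2 - f i (t - 1) \<omega> * (incr t \<omega> v* P) $ i))
          \<le> scalar_cost (l i) T (\<lambda>t. (v t \<omega> v* P) $ i) (\<lambda>t. (x t \<omega> v* P) $ i)"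
        using x_0[OF that]
        by (subst scalar_cost_decomp[OF l order_refl])
          (simp_all add: f_def vector_matrix_mult_diff_distrib)
    qed
    ultimately show ?thesis
      unfolding expected_cost_def c_def by (rule has_bochner_integral_le_nn_integral)
  qed simp
qed

text \<open>When \<open>gain\<close> starts at \<open>q\<close>, the update of LAI makes every
  square in \<open>scalar_cost_decomp\<close> vanish; the only term discarded is
  \<open>- q * y^2 / 2\<close> for the final deviation \<open>y\<close>.\<close>

lemma expected_cost_lai_le:
  fixes P A :: "real^'n^'n"
  assumes P: "orthogonal_matrix P" and A: "A = P ** diag_matrix l ** transpose P"
    and l: "\<And>i. 0 < l i" and q: "\<And>i. 0 \<le> q i"
    and end_eig: "\<And>i. lai_terminal_eig \<gamma> (l i) = 1 / (1 + l i + q i)"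
  shows "expected_cost A T M v (\<lambda>t \<omega>. lai P l A \<gamma> T x0 (\<lambda>s. v s \<omega>) t)
    \<le> ennreal (\<Sum>i\<in>UNIV. coord_var P S i / 2 * (\<Sum>t = 1..T. gain (l i) (q i) (Suc T - t)))"
proof -
  define x where "x = (\<lambda>t \<omega>. lai P l A \<gamma> T x0 (\<lambda>s. v s \<omega>) t)"
  define f where "f = (\<lambda>i t \<omega>. (x t \<omega> v* P) $ i - (v t \<omega> v* P) $ i)"
  define c where "c = (\<lambda>\<omega>. total_cost A T (\<lambda>t. v t \<omega>) (\<lambda>t. x t \<omega>))"
  have c_eq: "c \<omega> = (\<Sum>i\<in>UNIV. scalar_cost (l i) T (\<lambda>t. (v t \<omega> v* P) $ i) (\<lambda>t. (x t \<omega> v* P) $ i))" for \<omega>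
    unfolding c_def by (rule total_cost_coords[OF P A])
  have x_0: "x 0 \<omega> = v 0 \<omega>" if "\<omega> \<in> space M" for \<omega>
    using that by (simp add: x_def v_0)
  have step: "(x t \<omega> v* P) $ i - (v t \<omega> v* P) $ i
      = ((x (t - 1) \<omega> v* P) $ i - (v t \<omega> v* P) $ i) / (1 + l i + gain (l i) (q i) (T - t))"
    if "t \<in> {1..T}" for i t \<omega>
    unfolding x_def using that by (intro lai_coords[OF P A l q end_eig])
  have f_step: "f i (Suc t) \<omega> = (f i t \<omega> - (incr (Suc t) \<omega> v* P) $ i)
      / (1 + l i + gain (l i) (q i) (T - Suc t))" if "Suc t \<le> T" for i t \<omega>
    using step[of "Suc t" \<omega> i] that by (simp add: f_def vector_matrix_mult_diff_distrib)
  \<comment> \<open>By \<open>f_step\<close> the deviations obey a linear recursion driven by the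
    increments, which propagates adaptedness and square integrability from time 0.\<close>
  have f: "f i t \<in> borel_measurable (nat_filt M v t) \<and> integrable M (\<lambda>\<omega>. (f i t \<omega>)\<^sup>2)"
    if "t \<le> T" for i t
    using that
  proof (induction t)
    case 0
    have "integrable M (\<lambda>\<omega>. (f i 0 \<omega>)\<^sup>2) \<longleftrightarrow> integrable M (\<lambda>_. 0 :: real)"
      by (rule Bochner_Integration.integrable_cong) (auto simp: f_def x_0)
    moreover have "f i 0 \<in> borel_measurable (nat_filt M v 0)"
      unfolding f_def x_def lai.simps
      by (intro borel_measurable_diff borel_measurable_coord adapted_v) simp_all
    ultimately show ?case by simp
  next
    case (Suc t)
    define d where "d = (\<lambda>\<omega>. (incr (Suc t) \<omega> v* P) $ i)"
    define k where "k = 1 + l i + gain (l i) (q i) (T - Suc t)"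
    have fS: "f i (Suc t) = (\<lambda>\<omega>. (f i t \<omega> - d \<omega>) / k)"
      using f_step[OF Suc.prems] by (auto simp: d_def k_def)
    have IH: "f i t \<in> borel_measurable (nat_filt M v t)" "integrable M (\<lambda>\<omega>. (f i t \<omega>)\<^sup>2)"
      using Suc by auto
    have d: "d \<in> borel_measurable (nat_filt M v (Suc t))"
      unfolding d_def
      by (intro borel_measurable_coord borel_measurable_diff adapted_v
          measurable_nat_filt_mono[OF adapted_v]) simp
    have d2: "integrable M (\<lambda>\<omega>. (d \<omega>)\<^sup>2)"
      using has_integral_incr_coord[of "Suc t" P i] Suc.prems
      by (simp add: d_def has_bochner_integral_iff)
    have "integrable M (\<lambda>\<omega>. f i t \<omega> * d \<omega>)"
      using IH d d2 Suc.prems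
      by (intro integrable_mult_of_squares measurable_nat_filt_M[of "f i t" t]
          measurable_nat_filt_M[of d "Suc t"]) auto
    then have "integrable M (\<lambda>\<omega>. ((f i t \<omega>)\<^sup>2 + (d \<omega>)\<^sup>2 - 2 * (f i t \<omega> * d \<omega>)) / k\<^sup>2)"
      using IH d2 by simp
    then have "integrable M (\<lambda>\<omega>. (f i (Suc t) \<omega>)\<^sup>2)"
      by (simp add: fS power_divide power2_diff mult.assoc)
    moreover have "f i (Suc t) \<in> borel_measurable (nat_filt M v (Suc t))"
      unfolding fS using measurable_nat_filt_mono[OF IH(1), of "Suc t"] d by simp
    ultimately show ?case by simp
  qed
  define U where "U = (\<lambda>\<omega>. \<Sum>i\<in>UNIV. \<Sum>t = 1..T. gain (l i) (q i) (Suc T - t)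
      * (((incr t \<omega> v* P) $ i)\<^sup>2 / 2 - f i (t - 1) \<omega> * (incr t \<omega> v* P) $ i))"
  have U: "has_bochner_integral M U
      (\<Sum>i\<in>UNIV. coord_var P S i / 2 * (\<Sum>t = 1..T. gain (l i) (q i) (Suc T - t)))"
    unfolding U_def by (intro has_bochner_integral_sum has_integral_weighted_incr) (use f in auto)
  have cU: "c \<omega> \<le> U \<omega>" if "\<omega> \<in> space M" for \<omega>
    unfolding U_def c_eq
  proof (rule sum_mono)
    fix i
    have "0 \<le> q i * ((x T \<omega> v* P) $ i - (v T \<omega> v* P) $ i)\<^sup>2 / 2" using q[of i] by simp
    then show "scalar_cost (l i) T (\<lambda>t. (v t \<omega> v* P) $ i) (\<lambda>t. (x t \<omega> v* P) $ i)
        \<le> (\<Sum>t = 1..T. gain (l i) (q i) (Suc T - t)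
            * (((incr t \<omega> v* P) $ i)\<^sup>2 / 2 - f i (t - 1) \<omega> * (incr t \<omega> v* P) $ i))"
      using x_0[OF that]
      by (subst scalar_cost_decomp[OF l q[of i]]) (simp_all add: step f_def vector_matrix_mult_diff_distrib)
  qed
  have c_nonneg: "0 \<le> c \<omega>" for \<omega>
    unfolding c_eq using l by (intro sum_nonneg scalar_cost_nonneg) (simp add: less_imp_le)
  have "(\<integral>\<^sup>+ \<omega>. ennreal (c \<omega>) \<partial>M) \<le> (\<integral>\<^sup>+ \<omega>. ennreal (U \<omega>) \<partial>M)"
    by (intro nn_integral_mono ennreal_leI cU)
  \<comment> \<open>\<open>U\<close> dominates the nonnegative cost on the space, so it is
    nonnegative there and its two integrals agree.\<close>
  also have "\<dots> = ennreal (\<Sum>i\<in>UNIV. coord_var P S i / 2 * (\<Sum>t = 1..T. gain (l i) (q i) (Suc T - t)))"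
    using nn_integral_eq_integral[of M U] has_bochner_integral_integrable U
    by (metis (no_types, lifting) AE_I2 c_nonneg cU has_bochner_integral_iff order_trans)
  finally show ?thesis by (simp add: expected_cost_def c_def x_def)
qed

text \<open>The two cost bounds differ only in the starting value of \<open>gain\<close>. The half
  in \<open>coord_var P S i / 2\<close> and the half from
  \<open>terminal_weight_quotient_antimono\<close> give the quarter; the variances sum to the
  trace.\<close>

lemma regret_lai_le:
  fixes P A :: "real^'n^'n"
  assumes P: "orthogonal_matrix P" and A: "A = P ** diag_matrix l ** transpose P"
    and m: "0 < m" "\<And>i. m \<le> l i" and g: "0 \<le> \<gamma>" and T: "1 \<le> T"
  shows "regret A (lai P l A \<gamma>) T M x0 v
    \<le> ereal (trace S / 4 * (((1 + 4 / m) powr (\<gamma> / 2) - 1) / (m + 2)))"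
proof -
  define q where "q = (\<lambda>i. terminal_weight \<gamma> (l i))"
  define bound where "bound = ((1 + 4 / m) powr (\<gamma> / 2) - 1) / (m + 2)"
  have l: "0 < l i" for i using m less_le_trans by blast
  have q: "0 \<le> q i" for i unfolding q_def by (rule terminal_weight_nonneg[OF l g])
  have end_eig: "lai_terminal_eig \<gamma> (l i) = 1 / (1 + l i + q i)" for i
    unfolding q_def by (rule lai_terminal_eig_eq)
  define U where "U = (\<Sum>i\<in>UNIV. coord_var P S i / 2 * (\<Sum>t = 1..T. gain (l i) (q i) (Suc T - t)))"
  define L where "L = (\<Sum>i\<in>UNIV. coord_var P S i / 2 * (\<Sum>t = 1..T. gain (l i) 0 (Suc T - t)))"
  have nonneg: "0 \<le> U" "0 \<le> L"
    unfolding U_def L_def using gain_nonneg[OF l q] gain_nonneg[OF l order_refl] coord_var_nonneg[OF T]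
    by (simp_all add: sum_nonneg)
  have "U - L = (\<Sum>i\<in>UNIV. coord_var P S i / 2
      * (\<Sum>t = 1..T. gain (l i) (q i) (Suc T - t) - gain (l i) 0 (Suc T - t)))"
    unfolding U_def L_def by (simp add: sum_subtractf right_diff_distrib)
  also have "\<dots> \<le> (\<Sum>i\<in>UNIV. coord_var P S i / 2 * (bound / 2))"
  proof (intro sum_mono mult_left_mono)
    fix i
    have "(\<Sum>t = 1..T. gain (l i) (q i) (Suc T - t) - gain (l i) 0 (Suc T - t))
        \<le> q i / (l i * (l i + 2))"
      by (rule sum_gain_diff_le[OF l q])
    also have "\<dots> \<le> bound / 2"
      unfolding q_def bound_def by (rule terminal_weight_quotient_antimono[OF m g])
    finally show "(\<Sum>t = 1..T. gain (l i) (q i) (Suc T - t) - gain (l i) 0 (Suc T - t)) \<le> bound / 2" .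
  qed (simp add: coord_var_nonneg[OF T])
  also have "\<dots> = trace S / 4 * bound"
    unfolding sum_coord_var[OF P, of S, symmetric] by (simp add: sum_distrib_right sum_divide_distrib)
  finally have UL: "U - L \<le> trace S / 4 * bound" .
  have "regret A (lai P l A \<gamma>) T M x0 v \<le> enn2ereal (ennreal U) - enn2ereal (ennreal L)"
    unfolding regret_def
    using expected_cost_lai_le[OF P A l q end_eig] optimal_expected_cost_ge[OF P A l]
    by (intro ereal_minus_mono) (auto simp: U_def L_def less_eq_ennreal.rep_eq[symmetric])
  also have "\<dots> = ereal (U - L)" using nonneg by (simp add: enn2ereal_ennreal)
  also have "\<dots> \<le> ereal (trace S / 4 * bound)" using UL by simp
  finally show ?thesis by (simp only: bound_def)
qed

end

section \<open>The competitive ratio\<close>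

text \<open>Any comparison trajectory is treated coordinate by coordinate with ratio
  \<open>1 + 1 / (l i + q i)\<close>. Monotonicity bounds all of these by the ratio at
  \<open>m\<close>, and a common ratio survives summation.\<close>

lemma competitive_ratio_lai:
  fixes P A :: "real^'n^'n"
  assumes P: "orthogonal_matrix P" and A: "A = P ** diag_matrix l ** transpose P"
    and m: "0 < m" "\<And>i. m \<le> l i" and g: "0 \<le> \<gamma>" "\<gamma> \<le> 1"
    and \<rho>: "1 + 1 / (m + terminal_weight \<gamma> m) \<le> \<rho>"
  shows "competitive_ratio_le A (lai P l A \<gamma>) \<rho>"
  unfolding competitive_ratio_le_def
proof (intro allI impI)
  fix T :: nat and x0 :: "real^'n" and v :: "nat \<Rightarrow> real^'n"
  define x where "x = lai P l A \<gamma> T x0 v"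
  define q where "q = (\<lambda>i. terminal_weight \<gamma> (l i))"
  have l: "0 < l i" for i using m less_le_trans by blast
  have q: "0 \<le> q i" for i unfolding q_def by (rule terminal_weight_nonneg[OF l g(1)])
  have fp: "(q i)\<^sup>2 + l i * q i \<le> l i" for i
    unfolding q_def by (rule terminal_weight_le[OF l g])
  have end_eig: "lai_terminal_eig \<gamma> (l i) = 1 / (1 + l i + q i)" for i
    unfolding q_def by (rule lai_terminal_eig_eq)
  have wm: "0 \<le> terminal_weight \<gamma> m" by (rule terminal_weight_nonneg[OF m(1) g(1)])
  then have "0 \<le> 1 / (m + terminal_weight \<gamma> m)" using m by simp
  then have pos: "0 < \<rho>" using \<rho> by linarith
  have le: "total_cost A T v x \<le> \<rho> * total_cost A T v y" if y: "y 0 = x0" for y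
  proof -
    have "scalar_cost (l i) T (\<lambda>t. (v t v* P) $ i) (\<lambda>t. (x t v* P) $ i)
        \<le> \<rho> * scalar_cost (l i) T (\<lambda>t. (v t v* P) $ i) (\<lambda>t. (y t v* P) $ i)" for i
    proof -
      have "scalar_cost (l i) T (\<lambda>t. (v t v* P) $ i) (\<lambda>t. (x t v* P) $ i)
          \<le> (1 + 1 / (l i + q i)) * scalar_cost (l i) T (\<lambda>t. (v t v* P) $ i) (\<lambda>t. (y t v* P) $ i)"
      proof (rule scalar_competitive[OF l q fp])
        show "(x 0 v* P) $ i = (y 0 v* P) $ i" by (simp add: x_def y)
      qed (unfold x_def, rule lai_coords[OF P A l q end_eig])
      also have "\<dots> \<le> \<rho> * scalar_cost (l i) T (\<lambda>t. (v t v* P) $ i) (\<lambda>t. (y t v* P) $ i)"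
      proof (rule mult_right_mono)
        have "1 / (l i + q i) \<le> 1 / (m + terminal_weight \<gamma> m)"
          unfolding q_def using m wm add_terminal_weight_mono[OF m g, of i]
          by (intro divide_left_mono mult_pos_pos) auto
        then show "1 + 1 / (l i + q i) \<le> \<rho>" using \<rho> by simp
        show "0 \<le> scalar_cost (l i) T (\<lambda>t. (v t v* P) $ i) (\<lambda>t. (y t v* P) $ i)"
          using l[of i] by (intro scalar_cost_nonneg) simp
      qed
      finally show ?thesis .
    qed
    then show ?thesis
      unfolding total_cost_coords[OF P A] sum_distrib_left by (intro sum_mono)
  qed
  \<comment> \<open>Dividing by the positive ratio turns the bound against each trajectory into a
    lower bound for the infimum.\<close>
  have "total_cost A T v x / \<rho> \<le> offline_cost A T x0 v"
    unfolding offline_cost_def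
  proof (rule cINF_greatest)
    show "{y. y 0 = x0} \<noteq> {}" by (auto intro: exI[of _ "\<lambda>_. x0"])
    show "total_cost A T v x / \<rho> \<le> total_cost A T v y" if "y \<in> {y. y 0 = x0}" for y
      using le[of y] that pos by (simp add: field_simps)
  qed
  then show "total_cost A T v (lai P l A \<gamma> T x0 v) \<le> \<rho> * offline_cost A T x0 v"
    using pos by (simp add: x_def field_simps)
qed

theorem theorem3p11:
  fixes A P :: "real^'n^'n" and l :: "'n \<Rightarrow> real" and \<gamma> :: real
  assumes "sym_pos_def A"
    and "orthogonal_matrix P" and "A = P ** diag_matrix l ** transpose P"
    and "0 \<le> \<gamma>" and "\<gamma> \<le> 1"
  shows "(\<forall>(M :: 'a measure) T x0 v \<Sigma>.
            prob_space M \<and> 1 \<le> T \<and> martingale_minimizers M T x0 v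
              \<and> increments_covariance M T v \<Sigma> \<longrightarrow>
            regret A (lai P l A \<gamma>) T M x0 v
              \<le> ereal (trace \<Sigma> / 4
                  * (((1 + 4 / lambda_min A) powr (\<gamma> / 2) - 1) / (lambda_min A + 2))))
       \<and> competitive_ratio_le A (lai P l A \<gamma>)
           (1 + max ((sqrt ((cond_number A)\<^sup>2 + 4 * cond_number A / lambda_min A)
                        - cond_number A) / 2)
                    (2 / lambda_min A
                       * inverse ((1 + 4 / lambda_min A) powr (\<gamma> / 2) + 1)))"
proof -
  have eig: "eigenvalues A = range l" by (rule eigenvalues_conj_diag[OF assms(2,3)])
  \<comment> \<open>An eigenvector satisfies
    \<open>x \<bullet> (A *v x) = r * (x \<bullet> x)\<close>, and both inner products are
    positive.\<close>
  have pos: "0 < r" if r: "r \<in> eigenvalues A" for r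
  proof -
    obtain x where x: "x \<noteq> 0" "A *v x = r *\<^sub>R x" using r by (auto simp: eigenvalues_def)
    then have "0 < r * (x \<bullet> x)" using assms(1) by (auto simp: sym_pos_def_def)
    moreover have "0 < x \<bullet> x" using x(1) by simp
    ultimately show ?thesis by (rule zero_less_mult_pos2)
  qed
  have "lambda_min A \<in> eigenvalues A" unfolding lambda_min_def eig by (intro Min_in) auto
  then have m: "0 < lambda_min A" by (rule pos)
  have ml: "lambda_min A \<le> l i" for i unfolding lambda_min_def eig by (intro Min_le) auto
  have "regret A (lai P l A \<gamma>) T M x0 v
      \<le> ereal (trace S / 4 * (((1 + 4 / lambda_min A) powr (\<gamma> / 2) - 1) / (lambda_min A + 2)))"
    if "prob_space M" "1 \<le> T" "martingale_minimizers M T x0 v" "increments_covariance M T v S"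
    for M :: "'a measure" and T x0 v S
  proof -
    interpret martingale_setting M T x0 v S
      using that by (intro martingale_setting.intro martingale_setting_axioms.intro)
    show ?thesis by (rule regret_lai_le[OF assms(2,3) m ml assms(4) that(2)])
  qed
  \<comment> \<open>By \<open>inverse_terminal_weight\<close> the second argument of the maximum
    equals \<open>1 / (m + terminal_weight \<gamma> m)\<close> at
    \<open>m = lambda_min A\<close>.\<close>
  moreover have "competitive_ratio_le A (lai P l A \<gamma>)
      (1 + max ((sqrt ((cond_number A)\<^sup>2 + 4 * cond_number A / lambda_min A) - cond_number A) / 2)
        (2 / lambda_min A * inverse ((1 + 4 / lambda_min A) powr (\<gamma> / 2) + 1)))"
    by (rule competitive_ratio_lai[OF assms(2,3) m ml assms(4,5)])
      (simp only: inverse_terminal_weight[OF m] add_left_mono max.cobounded2)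
  ultimately show ?thesis by blast
qed

end
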